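(* Let $\mathcal{C}$, $\mathrm{odd}(m)$ and $\mathrm{even}(n)$ (for $m,n\in\mathbb{N}\setminus\{0\}$) be as defined in the context. The following facts hold. 1. $$\mathcal{C}=\bigcup_{m\in\mathbb{N}\setminus\{0\}}\mathrm{odd}(m)=\bigcup_{n\in\mathbb{N}\setminus\{0\}}\mathrm{even}(n).$$ 2. For all $m_1,m_2\in\mathbb{N}\setminus\{0\}$ with $m_1\neq m_2$, $\mathrm{odd}(m_1)\cap\mathrm{odd}(m_2)=\emptyset$. Likewise, for all $n_1,n_2\in\mathbb{N}\setminus\{0\}$ with $n_1\neq n_2$, $\mathrm{even}(n_1)\cap\mathrm{even}(n_2)=\emptyset$. 3. For every $(a,b,c)\in\mathcal{C}$ there exist $m,n\in\mathbb{N}\setminus\{0\}$ such that $(a,b,c)\in\mathrm{odd}(m)\cap\mathrm{even}(n)$. Conversely, for all $m,n\in\mathbb{N}\setminus\{0\}$, the intersection $\mathrm{odd}(m)\cap\mathrm{even}(n)\subseteq\mathcal{C}$ contains exactly one Pythagorean triple. 4. Let $m,n\in\mathbb{N}\setminus\{0\}$. The triple $(a,b,c)\in\mathcal{C}$ such that $c-b=(2m-1)^2$ and $c-a=2n^2$ is given by $$a=-2n+4nm+4m^2-4m+1,$$ $$b=2n^2-2n+4nm,$$ $$c=2n^2-2n+4nm+4m^2-4m+1,$$ and this representation is unique, i.e. $(m,n)$ is the only pair of elements of $\mathbb{N}\setminus\{0\}$ for which these three equations hold for the triple $(a,b,c)$.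
   Context: A Pythagorean triple is an ordered triple $(a,b,c)$ with $a,b,c\in\mathbb{N}\setminus\{0\}$ and $a^2+b^2=c^2$. The set $\mathcal{C}$ is the set of Pythagorean triples $$\mathcal{C}=\{(u^2-v^2,\,2uv,\,u^2+v^2)\;|\;u,v\in\mathbb{N}\setminus\{0\},\ u>v,\ u-v\text{ is odd}\}.$$ Triples in $\mathcal{C}$ are ordered as displayed, so $a$ is odd, $b$ is even and $c$ is odd for every $(a,b,c)\in\mathcal{C}$. For $m,n\in\mathbb{N}\setminus\{0\}$ define $$\mathrm{odd}(m)=\{(a,b,c)\in\mathcal{C}\;|\;c-b=(2m-1)^2\},\qquad \mathrm{even}(n)=\{(a,b,c)\in\mathcal{C}\;|\;c-a=2n^2\}.$$ *)

theory Defs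
  imports Main
begin

definition pythagorean_triple :: "nat \<times> nat \<times> nat \<Rightarrow> bool" where
  "pythagorean_triple = (\<lambda>(a, b, c). 0 < a \<and> 0 < b \<and> 0 < c \<and> a\<^sup>2 + b\<^sup>2 = c\<^sup>2)"

(* The condition v < u keeps both natural-number subtractions from truncating. *)
definition C_triples :: "(nat \<times> nat \<times> nat) set" where
  "C_triples = {(u\<^sup>2 - v\<^sup>2, 2 * u * v, u\<^sup>2 + v\<^sup>2) | u v.
     0 < u \<and> 0 < v \<and> v < u \<and> odd (u - v)}"

(* In the next two definitions differences are taken in the integers; the index is
   meant to be positive (odd_triples 0 would coincide with odd_triples 1). *)
definition odd_triples :: "nat \<Rightarrow> (nat \<times> nat \<times> nat) set" where
  "odd_triples m = {(a, b, c). (a, b, c) \<in> C_triples \<and> int c - int b = (2 * int m - 1)\<^sup>2}"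

definition even_triples :: "nat \<Rightarrow> (nat \<times> nat \<times> nat) set" where
  "even_triples n = {(a, b, c). (a, b, c) \<in> C_triples \<and> int c - int a = 2 * (int n)\<^sup>2}"

end

(* A triple of C generated by u and v satisfies c - b = (u - v)^2 and c - a = 2 v^2. So the
   index pair is determined by n = v and 2 m - 1 = u - v, and every pair (m, n) arises from exactly
   one admissible pair (u, v). *)

theory Submission
  imports Defs begin

text \<open>The usual generators are \<open>u = n + (2 * m - 1)\<close> and \<open>v = n\<close>;
  indexing by \<open>m\<close> and \<open>n\<close> turns the constraints on \<open>u\<close> and
  \<open>v\<close> into two independent positivity conditions. The subtraction
  \<open>2 * m - 1\<close> is exact for \<open>1 \<le> m\<close> and truncates to 0 at
  \<open>m = 0\<close>.\<close>

definition index_triple :: "nat \<Rightarrow> nat \<Rightarrow> nat \<times> nat \<times> nat" where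
  "index_triple m n =
     ((n + (2 * m - 1))\<^sup>2 - n\<^sup>2, 2 * (n + (2 * m - 1)) * n, (n + (2 * m - 1))\<^sup>2 + n\<^sup>2)"

lemma C_triples_eq: "C_triples = {index_triple m n | m n. 1 \<le> m \<and> 1 \<le> n}"
proof (intro set_eqI iffI)
  fix t assume "t \<in> C_triples"
  then obtain u v where t: "t = (u\<^sup>2 - v\<^sup>2, 2 * u * v, u\<^sup>2 + v\<^sup>2)"
    and uv: "0 < v" "v < u" "odd (u - v)"
    unfolding C_triples_def by blast
  from uv(3) obtain k where "u - v = 2 * k + 1" by (rule oddE)
  \<comment> \<open>The odd difference is \<open>2 * k + 1\<close> with \<open>k\<close> starting at
    0, while the index starts at 1, so the witness for \<open>m\<close> is
    \<open>Suc k\<close>.\<close>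
  with uv have "u = v + (2 * Suc k - 1)" by simp
  with t have "t = index_triple (Suc k) v" by (simp only: index_triple_def)
  with uv(1) show "t \<in> {index_triple m n | m n. 1 \<le> m \<and> 1 \<le> n}"
    by (force simp: Suc_le_eq)
next
  fix t assume "t \<in> {index_triple m n | m n. 1 \<le> m \<and> 1 \<le> n}"
  then obtain m n where "t = index_triple m n" and mn: "1 \<le> m" "1 \<le> n" by blast
  moreover have "odd (n + (2 * m - 1) - n)" using mn(1) by simp
  moreover have "0 < n + (2 * m - 1)" "0 < n" "n < n + (2 * m - 1)" using mn by auto
  ultimately show "t \<in> C_triples"
    unfolding C_triples_def index_triple_def by blast
qed

lemma index_triple_in_C: "1 \<le> m \<Longrightarrow> 1 \<le> n \<Longrightarrow> index_triple m n \<in> C_triples"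
  by (auto simp: C_triples_eq)

text \<open>Expanding the squares of \<open>n + (2 * m - 1)\<close> gives these polynomials. They
  are stated over the integers because their negative terms would truncate on naturals;
  \<open>1 \<le> m\<close> lets the generator itself pass to the integers exactly.\<close>

lemma index_triple_int:
  assumes "(a, b, c) = index_triple m n" and "1 \<le> m"
  shows "int a = - 2 * int n + 4 * int n * int m + 4 * (int m)\<^sup>2 - 4 * int m + 1"
    and "int b = 2 * (int n)\<^sup>2 - 2 * int n + 4 * int n * int m"
    and "int c = 2 * (int n)\<^sup>2 - 2 * int n + 4 * int n * int m + 4 * (int m)\<^sup>2 - 4 * int m + 1"
proof -
  define u where "u = n + (2 * m - 1)"
  have u: "int u = int n + 2 * int m - 1" using assms(2) by (simp add: u_def of_nat_diff)
  have abc: "a = u\<^sup>2 - n\<^sup>2" "b = 2 * u * n" "c = u\<^sup>2 + n\<^sup>2"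
    using assms(1) by (simp_all add: index_triple_def u_def)
  \<comment> \<open>This makes the natural subtraction in the first component exact.\<close>
  have "n\<^sup>2 \<le> u\<^sup>2" by (simp add: u_def power_mono)
  then have "int a = (int u)\<^sup>2 - (int n)\<^sup>2" by (simp add: abc of_nat_diff)
  then show "int a = - 2 * int n + 4 * int n * int m + 4 * (int m)\<^sup>2 - 4 * int m + 1"
    by (simp add: u power2_eq_square algebra_simps)
  show "int b = 2 * (int n)\<^sup>2 - 2 * int n + 4 * int n * int m"
    by (simp add: abc u power2_eq_square algebra_simps)
  show "int c = 2 * (int n)\<^sup>2 - 2 * int n + 4 * int n * int m + 4 * (int m)\<^sup>2 - 4 * int m + 1"
    by (simp add: abc u power2_eq_square algebra_simps)
qed

text \<open>In each difference of closed forms all mixed terms cancel, so each depends on one index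
  alone. This separates the two indices and drives all later uniqueness arguments.\<close>

lemma index_triple_diff:
  assumes "(a, b, c) = index_triple m n" and "1 \<le> m"
  shows "int c - int b = (2 * int m - 1)\<^sup>2" and "int c - int a = 2 * (int n)\<^sup>2"
  unfolding index_triple_int[OF assms] by (simp_all add: power2_eq_square algebra_simps)

text \<open>Both bases are positive, and squaring is injective there. Positivity matters: the
  indices 0 and 1 both give the square 1.\<close>

lemma odd_square_inject:
  fixes m m' :: nat
  assumes "1 \<le> m" "1 \<le> m'" and "(2 * int m - 1)\<^sup>2 = (2 * int m' - 1)\<^sup>2"
  shows "m = m'"
proof -
  have "2 * int m - 1 = 2 * int m' - 1"
    by (rule power2_eq_imp_eq[OF assms(3)]) (use assms in auto)
  then show ?thesis by simp
qed

text \<open>Picture the triples of \<open>C_triples\<close> as a grid indexed by \<open>m\<close>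
  and \<open>n\<close>. The value of \<open>c - b\<close> fixes \<open>m\<close> and leaves
  \<open>n\<close> free, so this family is a full row.\<close>

lemma odd_triples_eq:
  assumes "1 \<le> m"
  shows "odd_triples m = index_triple m ` {1..}"
proof (intro set_eqI iffI)
  fix t assume t: "t \<in> odd_triples m"
  obtain a b c where abc: "t = (a, b, c)" by (cases t)
  from t have C: "(a, b, c) \<in> C_triples" and d: "int c - int b = (2 * int m - 1)\<^sup>2"
    by (auto simp: odd_triples_def abc)
  from C obtain m' n where eq: "(a, b, c) = index_triple m' n" and le: "1 \<le> m'" "1 \<le> n"
    by (auto simp: C_triples_eq)
  have "m' = m"
    using odd_square_inject[OF le(1) assms] index_triple_diff(1)[OF eq le(1)] d by simp
  with eq le abc show "t \<in> index_triple m ` {1..}" by auto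
next
  fix t assume "t \<in> index_triple m ` {1..}"
  then obtain n where n: "1 \<le> n" "t = index_triple m n" by auto
  obtain a b c where abc: "t = (a, b, c)" by (cases t)
  then have "(a, b, c) = index_triple m n" "(a, b, c) \<in> C_triples"
    using n index_triple_in_C[OF assms n(1)] by simp_all
  then show "t \<in> odd_triples m"
    using index_triple_diff(1)[OF _ assms] unfolding odd_triples_def abc by blast
qed

text \<open>The column counterpart: \<open>c - a\<close> fixes \<open>n\<close>, because squaring is
  injective on nonnegative integers, and leaves \<open>m\<close> free.\<close>

lemma even_triples_eq:
  assumes "1 \<le> n"
  shows "even_triples n = (\<lambda>m. index_triple m n) ` {1..}"
proof (intro set_eqI iffI)
  fix t assume t: "t \<in> even_triples n"
  obtain a b c where abc: "t = (a, b, c)" by (cases t)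
  from t have C: "(a, b, c) \<in> C_triples" and d: "int c - int a = 2 * (int n)\<^sup>2"
    by (auto simp: even_triples_def abc)
  from C obtain m n' where eq: "(a, b, c) = index_triple m n'" and le: "1 \<le> m" "1 \<le> n'"
    by (auto simp: C_triples_eq)
  have "n' = n"
    using index_triple_diff(2)[OF eq le(1)] d by (simp add: power2_eq_iff_nonneg)
  with eq le abc show "t \<in> (\<lambda>m. index_triple m n) ` {1..}" by auto
next
  fix t assume "t \<in> (\<lambda>m. index_triple m n) ` {1..}"
  then obtain m where m: "1 \<le> m" "t = index_triple m n" by auto
  obtain a b c where abc: "t = (a, b, c)" by (cases t)
  then have "(a, b, c) = index_triple m n" "(a, b, c) \<in> C_triples"
    using m index_triple_in_C[OF m(1) assms] by simp_all
  then show "t \<in> even_triples n"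
    using index_triple_diff(2)[OF _ m(1)] unfolding even_triples_def abc by blast
qed

lemma odd_triples_disjoint:
  assumes "1 \<le> m1" "1 \<le> m2" "m1 \<noteq> m2"
  shows "odd_triples m1 \<inter> odd_triples m2 = {}"
  using odd_square_inject[OF assms(1,2)] assms(3) by (auto simp: odd_triples_def)

lemma even_triples_disjoint:
  assumes "n1 \<noteq> n2"
  shows "even_triples n1 \<inter> even_triples n2 = {}"
  using assms by (auto simp: even_triples_def power2_eq_iff_nonneg)

text \<open>A row and a column meet in one cell. A member of the row is
  \<open>index_triple m n'\<close> for some \<open>n'\<close>, hence also lies in column
  \<open>n'\<close>; since distinct columns are disjoint, \<open>n' = n\<close>.\<close>

lemma odd_Int_even:
  assumes "1 \<le> m" "1 \<le> n"
  shows "odd_triples m \<inter> even_triples n = {index_triple m n}"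
proof
  show "{index_triple m n} \<subseteq> odd_triples m \<inter> even_triples n"
    using assms by (auto simp: odd_triples_eq even_triples_eq)
  show "odd_triples m \<inter> even_triples n \<subseteq> {index_triple m n}"
  proof
    fix t assume t: "t \<in> odd_triples m \<inter> even_triples n"
    then obtain n' where n': "1 \<le> n'" "t = index_triple m n'"
      using assms(1) by (auto simp: odd_triples_eq)
    then have "t \<in> even_triples n'" using assms(1) by (auto simp: even_triples_eq)
    with t even_triples_disjoint[of n n'] have "n' = n" by blast
    with n' show "t \<in> {index_triple m n}" by simp
  qed
qed

text \<open>This is Euclid's identity for the generators \<open>u\<close> and \<open>n\<close>. It
  is proved separately because \<open>C_triples\<close> is defined by a parametrization that does
  not mention the Pythagorean equation.\<close>

lemma pythagorean_index_triple:
  assumes "1 \<le> m" "1 \<le> n"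
  shows "pythagorean_triple (index_triple m n)"
proof -
  define u where u: "u = n + (2 * m - 1)"
  have less: "n < u" using assms(1) by (simp add: u)
  then have sq: "n\<^sup>2 < u\<^sup>2" by (simp add: power_strict_mono)
  \<comment> \<open>The identity is checked in the integers, where the subtraction expands freely,
    and then carried back to naturals by injectivity of \<open>int\<close>. The strict inequality
    \<open>sq\<close> serves again below, for positivity of the first component.\<close>
  have "int (u\<^sup>2 - n\<^sup>2) = (int u)\<^sup>2 - (int n)\<^sup>2" using sq by (simp add: of_nat_diff less_imp_le)
  then have "int ((u\<^sup>2 - n\<^sup>2)\<^sup>2 + (2 * u * n)\<^sup>2) =
      ((int u)\<^sup>2 - (int n)\<^sup>2)\<^sup>2 + (2 * int u * int n)\<^sup>2"
    by (simp only: of_nat_add of_nat_mult of_nat_power of_nat_numeral)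
  also have "\<dots> = int ((u\<^sup>2 + n\<^sup>2)\<^sup>2)"
    by (simp add: power2_eq_square algebra_simps)
  finally have "int ((u\<^sup>2 - n\<^sup>2)\<^sup>2 + (2 * u * n)\<^sup>2) = int ((u\<^sup>2 + n\<^sup>2)\<^sup>2)" .
  then have "(u\<^sup>2 - n\<^sup>2)\<^sup>2 + (2 * u * n)\<^sup>2 = (u\<^sup>2 + n\<^sup>2)\<^sup>2"
    by (simp only: of_nat_eq_iff)
  with less sq assms(2) have "pythagorean_triple (u\<^sup>2 - n\<^sup>2, 2 * u * n, u\<^sup>2 + n\<^sup>2)"
    by (simp add: pythagorean_triple_def)
  then show ?thesis unfolding index_triple_def u .
qed

text \<open>Every cell of the grid lies in its own row and column. This yields the nontrivial
  inclusion of both union equalities.\<close>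

lemma C_triples_odd_even:
  assumes "t \<in> C_triples"
  shows "\<exists>m\<ge>1. \<exists>n\<ge>1. t \<in> odd_triples m \<inter> even_triples n"
proof -
  from assms obtain m n where "t = index_triple m n" "1 \<le> m" "1 \<le> n"
    by (auto simp: C_triples_eq)
  with odd_Int_even show ?thesis by blast
qed

theorem theorem1:
  shows "(C_triples = (\<Union>m\<in>{1..}. odd_triples m) \<and> C_triples = (\<Union>n\<in>{1..}. even_triples n)) \<and>
     ((\<forall>m1\<ge>1. \<forall>m2\<ge>1. m1 \<noteq> m2 \<longrightarrow> odd_triples m1 \<inter> odd_triples m2 = {}) \<and>
         (\<forall>n1\<ge>1. \<forall>n2\<ge>1. n1 \<noteq> n2 \<longrightarrow> even_triples n1 \<inter> even_triples n2 = {})) \<and>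
     ((\<forall>(a, b, c) \<in> C_triples. \<exists>m\<ge>1. \<exists>n\<ge>1. (a, b, c) \<in> odd_triples m \<inter> even_triples n) \<and>
         (\<forall>m\<ge>1. \<forall>n\<ge>1. odd_triples m \<inter> even_triples n \<subseteq> C_triples \<and>
            (\<exists>t. pythagorean_triple t \<and> odd_triples m \<inter> even_triples n = {t}))) \<and>
     (\<forall>m\<ge>1. \<forall>n\<ge>1.
         (\<exists>!(a, b, c). (a, b, c) \<in> C_triples \<and>
            int c - int b = (2 * int m - 1)\<^sup>2 \<and> int c - int a = 2 * (int n)\<^sup>2) \<and>
         (\<forall>(a, b, c) \<in> C_triples.
            int c - int b = (2 * int m - 1)\<^sup>2 \<and> int c - int a = 2 * (int n)\<^sup>2 \<longrightarrow>
              int a = - 2 * int n + 4 * int n * int m + 4 * (int m)\<^sup>2 - 4 * int m + 1 \<and>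
              int b = 2 * (int n)\<^sup>2 - 2 * int n + 4 * int n * int m \<and>
              int c = 2 * (int n)\<^sup>2 - 2 * int n + 4 * int n * int m + 4 * (int m)\<^sup>2 - 4 * int m + 1 \<and>
              (\<forall>m'\<ge>1. \<forall>n'\<ge>1.
                 int a = - 2 * int n' + 4 * int n' * int m' + 4 * (int m')\<^sup>2 - 4 * int m' + 1 \<and>
                 int b = 2 * (int n')\<^sup>2 - 2 * int n' + 4 * int n' * int m' \<and>
                 int c = 2 * (int n')\<^sup>2 - 2 * int n' + 4 * int n' * int m' + 4 * (int m')\<^sup>2 - 4 * int m' + 1
                 \<longrightarrow> m' = m \<and> n' = n)))"
proof (intro conjI)
  show "C_triples = (\<Union>m\<in>{1..}. odd_triples m)"
    using C_triples_odd_even by (fastforce simp: odd_triples_def)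
  show "C_triples = (\<Union>n\<in>{1..}. even_triples n)"
    using C_triples_odd_even by (fastforce simp: even_triples_def)
  show "\<forall>m1\<ge>1. \<forall>m2\<ge>1. m1 \<noteq> m2 \<longrightarrow> odd_triples m1 \<inter> odd_triples m2 = {}"
    using odd_triples_disjoint by blast
  show "\<forall>n1\<ge>1. \<forall>n2\<ge>1. n1 \<noteq> n2 \<longrightarrow> even_triples n1 \<inter> even_triples n2 = {}"
    using even_triples_disjoint by blast
  show "\<forall>(a, b, c) \<in> C_triples. \<exists>m\<ge>1. \<exists>n\<ge>1. (a, b, c) \<in> odd_triples m \<inter> even_triples n"
    using C_triples_odd_even by blast
  show "\<forall>m\<ge>1. \<forall>n\<ge>1. odd_triples m \<inter> even_triples n \<subseteq> C_triples \<and>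
      (\<exists>t. pythagorean_triple t \<and> odd_triples m \<inter> even_triples n = {t})"
    \<comment> \<open>The witness for \<open>t\<close> is \<open>index_triple m n\<close>.\<close>
    using odd_Int_even index_triple_in_C pythagorean_index_triple
    by (metis empty_subsetI insert_subset)
next
  \<comment> \<open>The two difference equations on \<open>C_triples\<close> say precisely that the
    triple lies in row \<open>m\<close> and column \<open>n\<close>, so they single out one cell.
    Existence and uniqueness of the triple follow at once, as does access to its closed
    forms.\<close>
  have char: "(a, b, c) \<in> C_triples \<and>
      int c - int b = (2 * int m - 1)\<^sup>2 \<and> int c - int a = 2 * (int n)\<^sup>2 \<longleftrightarrow>
      (a, b, c) = index_triple m n" (is "?L \<longleftrightarrow> _")
    if "1 \<le> m" "1 \<le> n" for a b c m n
  proof -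
    have "?L \<longleftrightarrow> (a, b, c) \<in> odd_triples m \<inter> even_triples n"
      by (auto simp: odd_triples_def even_triples_def)
    also have "\<dots> \<longleftrightarrow> (a, b, c) = index_triple m n"
      unfolding odd_Int_even[OF that] by simp
    finally show ?thesis .
  qed
  have unique: "\<exists>!(a, b, c). (a, b, c) \<in> C_triples \<and>
      int c - int b = (2 * int m - 1)\<^sup>2 \<and> int c - int a = 2 * (int n)\<^sup>2"
    if "1 \<le> m" "1 \<le> n" for m n
    by (rule ex1I[of _ "index_triple m n"])
      (use char[OF that] in \<open>auto split: prod.splits\<close>)
  \<comment> \<open>The primed equations are treated purely as polynomial formulas: subtracting them
    recovers \<open>(2 * int m' - 1)\<^sup>2\<close> and \<open>2 * (int n')\<^sup>2\<close>, which
    are compared with the differences computed from \<open>m\<close> and \<open>n\<close>.\<close>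
  have index_unique: "m' = m \<and> n' = n"
    if abc: "(a, b, c) = index_triple m n" and le: "1 \<le> m" "1 \<le> m'"
      and a: "int a = - 2 * int n' + 4 * int n' * int m' + 4 * (int m')\<^sup>2 - 4 * int m' + 1"
      and b: "int b = 2 * (int n')\<^sup>2 - 2 * int n' + 4 * int n' * int m'"
      and c: "int c = 2 * (int n')\<^sup>2 - 2 * int n' + 4 * int n' * int m' + 4 * (int m')\<^sup>2 - 4 * int m' + 1"
    for a b c m n m' n'
  proof
    have "int c - int b = (2 * int m' - 1)\<^sup>2"
      unfolding b c by (simp add: power2_eq_square algebra_simps)
    then show "m' = m"
      using odd_square_inject[OF le] index_triple_diff(1)[OF abc le(1)] by simp
    have "int c - int a = 2 * (int n')\<^sup>2" unfolding a c by simp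
    then show "n' = n"
      using index_triple_diff(2)[OF abc le(1)] by (simp add: power2_eq_iff_nonneg)
  qed
  show "\<forall>m\<ge>1. \<forall>n\<ge>1.
         (\<exists>!(a, b, c). (a, b, c) \<in> C_triples \<and>
            int c - int b = (2 * int m - 1)\<^sup>2 \<and> int c - int a = 2 * (int n)\<^sup>2) \<and>
         (\<forall>(a, b, c) \<in> C_triples.
            int c - int b = (2 * int m - 1)\<^sup>2 \<and> int c - int a = 2 * (int n)\<^sup>2 \<longrightarrow>
              int a = - 2 * int n + 4 * int n * int m + 4 * (int m)\<^sup>2 - 4 * int m + 1 \<and>
              int b = 2 * (int n)\<^sup>2 - 2 * int n + 4 * int n * int m \<and>
              int c = 2 * (int n)\<^sup>2 - 2 * int n + 4 * int n * int m + 4 * (int m)\<^sup>2 - 4 * int m + 1 \<and>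
              (\<forall>m'\<ge>1. \<forall>n'\<ge>1.
                 int a = - 2 * int n' + 4 * int n' * int m' + 4 * (int m')\<^sup>2 - 4 * int m' + 1 \<and>
                 int b = 2 * (int n')\<^sup>2 - 2 * int n' + 4 * int n' * int m' \<and>
                 int c = 2 * (int n')\<^sup>2 - 2 * int n' + 4 * int n' * int m' + 4 * (int m')\<^sup>2 - 4 * int m' + 1
                 \<longrightarrow> m' = m \<and> n' = n))"
  proof (intro allI impI conjI)
    fix m n :: nat assume "1 \<le> m" "1 \<le> n"
    then show "\<exists>!(a, b, c). (a, b, c) \<in> C_triples \<and>
        int c - int b = (2 * int m - 1)\<^sup>2 \<and> int c - int a = 2 * (int n)\<^sup>2"
      by (rule unique)
  next
    fix m n :: nat assume le: "1 \<le> m" "1 \<le> n"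
    show "\<forall>(a, b, c) \<in> C_triples.
            int c - int b = (2 * int m - 1)\<^sup>2 \<and> int c - int a = 2 * (int n)\<^sup>2 \<longrightarrow>
              int a = - 2 * int n + 4 * int n * int m + 4 * (int m)\<^sup>2 - 4 * int m + 1 \<and>
              int b = 2 * (int n)\<^sup>2 - 2 * int n + 4 * int n * int m \<and>
              int c = 2 * (int n)\<^sup>2 - 2 * int n + 4 * int n * int m + 4 * (int m)\<^sup>2 - 4 * int m + 1 \<and>
              (\<forall>m'\<ge>1. \<forall>n'\<ge>1.
                 int a = - 2 * int n' + 4 * int n' * int m' + 4 * (int m')\<^sup>2 - 4 * int m' + 1 \<and>
                 int b = 2 * (int n')\<^sup>2 - 2 * int n' + 4 * int n' * int m' \<and>
                 int c = 2 * (int n')\<^sup>2 - 2 * int n' + 4 * int n' * int m' + 4 * (int m')\<^sup>2 - 4 * int m' + 1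
                 \<longrightarrow> m' = m \<and> n' = n)"
    proof (clarify, goal_cases)
      case (1 a b c)
      \<comment> \<open>Once the triple is identified with its cell, the closed forms come from
        \<open>index_triple_int\<close> and the uniqueness of the index pair from
        \<open>index_unique\<close>.\<close>
      then have abc: "(a, b, c) = index_triple m n" using char[OF le] by blast
      show ?case
        using index_triple_int[OF abc le(1)] index_unique[OF abc le(1)] by blast
    qed
  qed
qed

end
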